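(* Let $N\in\mathbb{N}$, let $G=([N],A,g)$ be a strategic game with player set $[N]=\{1,\dots,N\}$, and let $v=v_G:2^{[N]}\to\mathbb{R}$ be the coalition game $$v(S)=\frac{\delta G(S)+\delta G([N])}{2},$$ where $\delta G(S)$ is the threat power of $S$. Let the hypercube graph on $2^{[N]}$ be equipped with the constant edge weight $\lambda\equiv 1$, and let $(X_n)_{n\ge 0}$ be the canonical Markov chain on it with $X_0=\emptyset$. For each player $i\in[N]$ and every coalition $S\subseteq[N]$ define the value allocation operator $$V_i(S):=\int_\Omega\sum_{n=1}^{\tau_{\emptyset,S}(\omega)}\mathrm{d}_iv\big(X_{n-1}(\omega),X_n(\omega)\big)\,d\mathcal{P}(\omega).$$ Then $V_i$ extends Nash's and Kohlberg and Neyman's value $\gamma$ in the sense that, for every $i\in[N]$, $$V_i([N])=\gamma_iG.$$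
   Context: Strategic games. A strategic game is a triple $G=([N],A,g)$ where $[N]=\{1,\dots,N\}$ is the set of players, $A=\prod_{i=1}^N A^i$ with $A^i$ the finite (nonempty) set of pure strategies of player $i$, and $g=(g^i)_{i\in[N]}$ with $g^i:A\to\mathbb{R}$ the payoff function of player $i$. For a finite set $K$, $\Delta(K)$ is the set of probability distributions on $K$; $g^i$ also denotes its linear extension $g^i:\Delta(A)\to\mathbb{R}$. For $S\subseteq[N]$, $A^S=\prod_{i\in S}A^i$ and $X^S=\Delta(A^S)$ (correlated strategies of the players in $S$; $A^\emptyset$ is a singleton). For $x\in X^S$ and $y\in X^{[N]\setminus S}$, $g^i(x,y)$ is the value of $g^i$ at the product distribution of $x$ and $y$. Threat power. For $S\subseteq[N]$, $$(\delta G)(S)=\max_{x\in X^S}\ \min_{y\in X^{[N]\setminus S}}\Big(\sum_{i\in S}g^i(x,y)-\sum_{i\notin S}g^i(x,y)\Big).$$ Nash's and Kohlberg and Neyman's value. $\gamma=(\gamma_1,\dots,\gamma_N)$ is the allocation map on $N$-player strategic games given by $$\gamma_iG=\frac{1}{N!}\sum_{\mathcal{R}}(\delta G)\big(\bar S_i^{\mathcal{R}}\big),$$ the sum being over all $N!$ orderings $\mathcal{R}$ of $[N]$, where $S_i^{\mathcal{R}}$ is the set of $j\in[N]$ that precede $i$ in $\mathcal{R}$ and $\bar S_i^{\mathcal{R}}=S_i^{\mathcal{R}}\cup\{i\}$. (By a theorem of Kohlberg and Neyman, this is the unique allocation map satisfying their axioms of efficiency, balanced threats, symmetry, null player and additivity.)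 Hypercube graph. Vertices are all $S\in 2^{[N]}$ and oriented edges are $(S,S\cup\{i\})$ with $i\in[N]$, $S\subseteq[N]\setminus\{i\}$. Two vertices are adjacent if they are joined by an edge in either orientation. With $\lambda\equiv1$, the canonical Markov chain $(X_n)_{n\ge0}$, defined on a probability space $(\Omega,\mathcal{F},\mathcal{P})$, starts at $X_0=\emptyset$ and at each step moves from the current vertex to a uniformly random adjacent vertex (simple random walk on the hypercube). $\tau_{\emptyset,S}$ is the first time $n\ge0$ at which $X_n=S$. Partial differential. For $v:2^{[N]}\to\mathbb{R}$ and $i\in[N]$, $\mathrm{d}_iv$ is the function on edges given by $\mathrm{d}_iv(S,S\cup\{j\})=v(S\cup\{i\})-v(S)$ if $j=i$ and $0$ if $j\ne i$ (for $S\subseteq[N]\setminus\{j\}$), extended to reversed edges by $\mathrm{d}_iv(T,S)=-\mathrm{d}_iv(S,T)$. *)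

theory Defs
  imports "HOL-Probability.Probability" "HOL-Combinatorics.Multiset_Permutations"
begin

text \<open>
  A game is given by the number \<open>N\<close> of players, the strategy sets \<open>A i\<close> and the payoffs \<open>g i\<close>.
  The elements of \<open>A\<^sup>S\<close> are the functions in \<open>Pi\<^sub>E S A\<close>, so that a payoff \<open>g i\<close> is only relevant on
  \<open>Pi\<^sub>E {1..N} A\<close>. Different players may have unrelated strategy sets inside the type \<open>'a\<close>.
\<close>

definition strategic_game :: "nat \<Rightarrow> (nat \<Rightarrow> 'a set) \<Rightarrow> bool" where
  "strategic_game N A \<longleftrightarrow> (\<forall>i\<in>{1..N}. finite (A i) \<and> A i \<noteq> {})"

definition correlated_strategies :: "(nat \<Rightarrow> 'a set) \<Rightarrow> nat set \<Rightarrow> (nat \<Rightarrow> 'a) pmf set" where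
  "correlated_strategies A S = {x. set_pmf x \<subseteq> Pi\<^sub>E S A}"

definition payoff :: "(nat \<Rightarrow> (nat \<Rightarrow> 'a) \<Rightarrow> real) \<Rightarrow> nat \<Rightarrow> (nat \<Rightarrow> 'a) pmf \<Rightarrow> real" where
  "payoff g i p = measure_pmf.expectation p (g i)"

definition joint_strategy ::
  "nat \<Rightarrow> nat set \<Rightarrow> (nat \<Rightarrow> 'a) pmf \<Rightarrow> (nat \<Rightarrow> 'a) pmf \<Rightarrow> (nat \<Rightarrow> 'a) pmf" where
  "joint_strategy N S x y = map_pmf (merge S ({1..N} - S)) (pair_pmf x y)"

text \<open>
  The sets of correlated strategies are compact simplices and the objective is bilinear, so the
  supremum and the infimum are a maximum and a minimum.
\<close>

definition threat_power ::
  "nat \<Rightarrow> (nat \<Rightarrow> 'a set) \<Rightarrow> (nat \<Rightarrow> (nat \<Rightarrow> 'a) \<Rightarrow> real) \<Rightarrow> nat set \<Rightarrow> real" where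
  "threat_power N A g S =
    (SUP x\<in>correlated_strategies A S. INF y\<in>correlated_strategies A ({1..N} - S).
      (\<Sum>i\<in>S. payoff g i (joint_strategy N S x y)) -
      (\<Sum>i\<in>{1..N} - S. payoff g i (joint_strategy N S x y)))"

definition predecessors :: "nat list \<Rightarrow> nat \<Rightarrow> nat set" where
  "predecessors R i = set (takeWhile (\<lambda>j. j \<noteq> i) R)"

definition kn_value ::
  "nat \<Rightarrow> (nat \<Rightarrow> 'a set) \<Rightarrow> (nat \<Rightarrow> (nat \<Rightarrow> 'a) \<Rightarrow> real) \<Rightarrow> nat \<Rightarrow> real" where
  "kn_value N A g i =
    (\<Sum>R\<in>permutations_of_set {1..N}. threat_power N A g (predecessors R i \<union> {i})) / fact N"

definition coalition_game ::
  "nat \<Rightarrow> (nat \<Rightarrow> 'a set) \<Rightarrow> (nat \<Rightarrow> (nat \<Rightarrow> 'a) \<Rightarrow> real) \<Rightarrow> nat set \<Rightarrow> real" where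
  "coalition_game N A g S = (threat_power N A g S + threat_power N A g {1..N}) / 2"

definition hypercube_edge :: "nat \<Rightarrow> nat set \<Rightarrow> nat set \<Rightarrow> bool" where
  "hypercube_edge N S T \<longleftrightarrow> (\<exists>j\<in>{1..N}. S \<subseteq> {1..N} - {j} \<and> T = S \<union> {j})"

definition neighbours :: "nat \<Rightarrow> nat set \<Rightarrow> nat set set" where
  "neighbours N S = {T. hypercube_edge N S T \<or> hypercube_edge N T S}"

definition partial_diff :: "nat \<Rightarrow> nat \<Rightarrow> (nat set \<Rightarrow> real) \<Rightarrow> nat set \<Rightarrow> nat set \<Rightarrow> real" where
  "partial_diff N i v S T =
    (if hypercube_edge N S T then (if T = S \<union> {i} then v (S \<union> {i}) - v S else 0)
     else if hypercube_edge N T S then - (if S = T \<union> {i} then v (T \<union> {i}) - v T else 0)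
     else 0)"

text \<open>
  The Markov property is stated in product form, which avoids conditioning on null events.
\<close>

locale hypercube_walk = prob_space M for M :: "'w measure" +
  fixes N :: nat and X :: "nat \<Rightarrow> 'w \<Rightarrow> nat set"
  assumes measurable_X: "\<And>n. X n \<in> measurable M (count_space (Pow {1..N}))"
    and start: "AE \<omega> in M. X 0 \<omega> = {}"
    and step: "\<And>n s. prob {\<omega> \<in> space M. \<forall>k\<le>Suc n. X k \<omega> = s k} =
      prob {\<omega> \<in> space M. \<forall>k\<le>n. X k \<omega> = s k} * pmf (pmf_of_set (neighbours N (s n))) (s (Suc n))"

definition hitting_time :: "(nat \<Rightarrow> 'w \<Rightarrow> nat set) \<Rightarrow> nat set \<Rightarrow> 'w \<Rightarrow> enat" where
  "hitting_time X S \<omega> = (INF n\<in>{n. X n \<omega> = S}. enat n)"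

text \<open>
  On the null event where \<open>S\<close> is never reached, the index set below is infinite and the sum is 0
  by convention.
\<close>

definition value_operator ::
  "nat \<Rightarrow> 'w measure \<Rightarrow> (nat \<Rightarrow> 'w \<Rightarrow> nat set) \<Rightarrow> (nat set \<Rightarrow> real) \<Rightarrow> nat \<Rightarrow> nat set \<Rightarrow> real" where
  "value_operator N M X v i S =
    (\<integral>\<omega>. (\<Sum>n | 1 \<le> n \<and> enat n \<le> hitting_time X S \<omega>.
      partial_diff N i v (X (n - 1) \<omega>) (X n \<omega>)) \<partial>M)"

end

theory Submission
  imports Defs
begin

text \<open>
  The argument has two independent parts: the value operator at the full set is the Shapley value of \<open>v\<close>,
  for an arbitrary \<open>v\<close>, and the Shapley value of the game \<open>v\<close> built from the threat power \<open>\<delta>\<close> is \<open>\<gamma>\<close>.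

  For the first part (\<open>value_operator_full\<close>), the expected sum of the increments of the stopped walk is the
  sum over all sets \<open>S\<close> of the expected number \<open>h S\<close> of visits to \<open>S\<close> before absorption, times the mean
  increment \<open>(v (S \<triangle> {i}) - v S) / N\<close> at \<open>S\<close>. Grouping \<open>S\<close> with \<open>S \<union> {i}\<close> turns this into the sum of
  \<open>(h S - h (S \<union> {i})) / N\<close> times the marginal contribution \<open>v (S \<union> {i}) - v S\<close>. The function \<open>h\<close> solves a
  discrete Poisson equation with source at the empty set and value 0 at the full set. The solution
  depends only on the cardinality, and its decrements are \<open>N\<close> times the Shapley weights
  \<open>s! (N - 1 - s)! / N!\<close> (\<open>radial_green_poisson\<close>). That \<open>h\<close> really is this solution follows from a
  comparison argument and the maximum principle (\<open>expected_visits\<close>).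

  For the second part, \<open>\<delta> S\<close> is the value of a zero-sum game between \<open>S\<close> and its complement, so the
  minimax theorem gives \<open>\<delta> ([N] - S) = - \<delta> S\<close> (\<open>threat_power_complement\<close>). The constant in \<open>v\<close> cancels in
  the marginal contributions, which are \<open>(\<delta> (S \<union> {i}) - \<delta> S) / 2\<close>. Reversing the orderings of the players
  shows that \<open>- \<delta> S\<close> contributes as much on average as \<open>\<delta> (S \<union> {i})\<close> (\<open>self_dual_marginals\<close>), which
  leaves the average of \<open>\<delta> (S \<union> {i})\<close> over the orderings.
\<close>

section \<open>The minimax theorem for finite games\<close>

text \<open>
  Think of \<open>f x\<close> as a payoff vector indexed by the opponent's pure strategies \<open>L\<close>. The hypothesis
  \<open>response\<close> says that each fixed mixture of the coordinates can be made nonnegative; the conclusion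
  provides one \<open>x\<close> that nearly does so for all coordinates at once. This is Blackwell's approach of the
  nonnegative orthant. The squared distance \<open>\<Phi>\<close> of \<open>f x\<close> to the orthant is the sum of the squared
  shortfalls. Choosing \<open>x'\<close> as a response to the shortfalls themselves makes the cross term in the
  expansion of \<open>\<Phi>\<close> favourable, so that mixing \<open>x'\<close> into \<open>x\<close> with weight \<open>t\<close> turns \<open>\<Phi>\<close> into at most
  \<open>(1 - t)\<^sup>2 \<Phi> + t\<^sup>2 D\<close>, and with \<open>t = 1 / (n + 1)\<close> a bound \<open>D / n\<close> becomes \<open>D / (n + 1)\<close>.
\<close>

lemma approachability:
  fixes f :: "'x \<Rightarrow> 'l \<Rightarrow> real"
  assumes fin: "finite L" and x0: "x0 \<in> C"
    and mix: "\<And>x x' t. x \<in> C \<Longrightarrow> x' \<in> C \<Longrightarrow> 0 \<le> t \<Longrightarrow> t \<le> 1 \<Longrightarrow>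
      \<exists>z\<in>C. \<forall>l\<in>L. f z l = (1 - t) * f x l + t * f x' l"
    and bounded: "\<And>x l. x \<in> C \<Longrightarrow> l \<in> L \<Longrightarrow> \<bar>f x l\<bar> \<le> B"
    and response: "\<And>w. (\<And>l. l \<in> L \<Longrightarrow> 0 \<le> w l) \<Longrightarrow> \<exists>x\<in>C. 0 \<le> (\<Sum>l\<in>L. w l * f x l)"
    and "0 < e"
  shows "\<exists>x\<in>C. \<forall>l\<in>L. - e \<le> f x l"
proof -
  define \<Phi> where "\<Phi> x = (\<Sum>l\<in>L. (max 0 (- f x l))\<^sup>2)" for x
  define D where "D = real (card L) * B\<^sup>2"
  have sq: "(f x l)\<^sup>2 \<le> B\<^sup>2" if "x \<in> C" "l \<in> L" for x l
    using bounded[OF that] by (metis abs_ge_zero abs_le_square_iff abs_of_nonneg order_trans)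
  have sumsq: "(\<Sum>l\<in>L. (f x l)\<^sup>2) \<le> D" if "x \<in> C" for x
    unfolding D_def using sum_bounded_above[of L "\<lambda>l. (f x l)\<^sup>2" "B\<^sup>2"] sq that by simp
  have rate: "\<exists>x\<in>C. \<Phi> x \<le> D / real (Suc n)" for n
  proof (induction n)
    case 0
    have "\<Phi> x0 \<le> (\<Sum>l\<in>L. (f x0 l)\<^sup>2)"
      unfolding \<Phi>_def by (intro sum_mono) (auto simp: max_def)
    with sumsq[OF x0] x0 show ?case by force
  next
    case (Suc n)
    then obtain x where x: "x \<in> C" and \<Phi>x: "\<Phi> x \<le> D / real (Suc n)" by blast
    \<comment> \<open>the shortfalls of x, used as the mixture to respond to\<close>
    define w where "w l = max 0 (- f x l)" for l
    obtain x' where x': "x' \<in> C" and orth: "0 \<le> (\<Sum>l\<in>L. w l * f x' l)"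
      using response[of w] by (auto simp: w_def)
    define t where "t = 1 / real (Suc (Suc n))"
    have t: "0 \<le> t" "t \<le> 1" by (auto simp: t_def)
    obtain z where z: "z \<in> C" and fz: "\<And>l. l \<in> L \<Longrightarrow> f z l = (1 - t) * f x l + t * f x' l"
      using mix[OF x x' t] by blast
    have "\<Phi> z \<le> (\<Sum>l\<in>L. ((1 - t) * w l - t * f x' l)\<^sup>2)"
      unfolding \<Phi>_def
    proof (intro sum_mono)
      fix l assume l: "l \<in> L"
      have "(1 - t) * (- f x l) \<le> (1 - t) * w l"
        using t by (intro mult_left_mono) (auto simp: w_def)
      then have "- f z l \<le> (1 - t) * w l - t * f x' l" using fz[OF l] by simp
      then have "\<bar>max 0 (- f z l)\<bar> \<le> \<bar>(1 - t) * w l - t * f x' l\<bar>" by (auto simp: max_def)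
      then show "(max 0 (- f z l))\<^sup>2 \<le> ((1 - t) * w l - t * f x' l)\<^sup>2"
        by (simp only: abs_le_square_iff)
    qed
    also have "\<dots> = (\<Sum>l\<in>L. (1 - t)\<^sup>2 * (w l)\<^sup>2 - 2 * t * (1 - t) * (w l * f x' l)
        + t\<^sup>2 * (f x' l)\<^sup>2)"
      by (intro sum.cong) (auto simp: power2_eq_square algebra_simps)
    also have "\<dots> = (1 - t)\<^sup>2 * \<Phi> x - 2 * t * (1 - t) * (\<Sum>l\<in>L. w l * f x' l)
        + t\<^sup>2 * (\<Sum>l\<in>L. (f x' l)\<^sup>2)"
      by (simp add: \<Phi>_def w_def sum.distrib sum_subtractf sum_distrib_left)
    also have "\<dots> \<le> (1 - t)\<^sup>2 * \<Phi> x + t\<^sup>2 * D"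
    proof -
      have "0 \<le> 2 * t * (1 - t) * (\<Sum>l\<in>L. w l * f x' l)" using orth t by simp
      moreover have "t\<^sup>2 * (\<Sum>l\<in>L. (f x' l)\<^sup>2) \<le> t\<^sup>2 * D"
        by (intro mult_left_mono sumsq x') simp
      ultimately show ?thesis by linarith
    qed
    also have "\<dots> \<le> (1 - t)\<^sup>2 * (D / real (Suc n)) + t\<^sup>2 * D"
      using \<Phi>x by (intro add_right_mono mult_left_mono) auto
    also have "\<dots> = D / real (Suc (Suc n))"
    proof -
      have "1 - t = real (Suc n) * t" by (simp add: t_def field_simps)
      then have "(1 - t)\<^sup>2 * (D / real (Suc n)) = t * D * (t * real (Suc n))"
        by (simp only: power2_eq_square) (simp del: of_nat_Suc)
      then have "(1 - t)\<^sup>2 * (D / real (Suc n)) + t\<^sup>2 * D = t * D * (t * real (Suc (Suc n)))"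
        by (simp add: power2_eq_square algebra_simps)
      also have "\<dots> = D / real (Suc (Suc n))" by (simp add: t_def)
      finally show ?thesis .
    qed
    finally show ?case using z by blast
  qed
  obtain n where n: "D / e\<^sup>2 < real n" using reals_Archimedean2 by blast
  have "D / real (Suc n) \<le> e\<^sup>2"
    using n \<open>0 < e\<close> by (simp add: field_simps) (smt (verit) zero_le_power2)
  then obtain x where x: "x \<in> C" and \<Phi>x: "\<Phi> x \<le> e\<^sup>2" using rate[of n] by force
  have "- e \<le> f x l" if "l \<in> L" for l
  proof -
    have "(max 0 (- f x l))\<^sup>2 \<le> \<Phi> x"
      unfolding \<Phi>_def using fin that by (intro member_le_sum) auto
    then have "(max 0 (- f x l))\<^sup>2 \<le> e\<^sup>2" using \<Phi>x by simp
    then have "max 0 (- f x l) \<le> e" by (rule power2_le_imp_le) (use \<open>0 < e\<close> in simp)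
    then show ?thesis by simp
  qed
  with x show ?thesis by blast
qed

lemma pmf_with_weights:
  fixes p :: "'k \<Rightarrow> real"
  assumes "finite K" and "\<And>a. a \<in> K \<Longrightarrow> 0 \<le> p a" and "sum p K = 1"
  shows "\<exists>x. set_pmf x \<subseteq> K \<and> (\<forall>a\<in>K. pmf x a = p a)"
proof -
  define q where "q a = (if a \<in> K then p a else 0)" for a
  have nonneg: "0 \<le> q a" for a using assms by (simp add: q_def)
  have "(\<integral>\<^sup>+a. ennreal (q a) \<partial>count_space UNIV) = (\<Sum>a\<in>K. ennreal (q a))"
    using assms by (intro nn_integral_count_space') (auto simp: q_def)
  also have "\<dots> = ennreal (sum q K)" using nonneg by simp
  also have "sum q K = 1" using assms by (simp add: q_def)
  finally have *: "pmf (embed_pmf q) a = q a" for a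
    using nonneg by (intro pmf_embed_pmf) auto
  have "set_pmf (embed_pmf q) \<subseteq> K" by (auto simp: set_pmf_iff * q_def split: if_splits)
  with * show ?thesis by (intro exI[of _ "embed_pmf q"]) (auto simp: q_def)
qed

lemma expectation_pair_pmf_finite:
  fixes c :: "'k \<Rightarrow> 'l \<Rightarrow> real"
  assumes "finite K" "finite L" "set_pmf x \<subseteq> K" "set_pmf y \<subseteq> L"
  shows "measure_pmf.expectation (pair_pmf x y) (\<lambda>(a, b). c a b) =
    (\<Sum>b\<in>L. pmf y b * (\<Sum>a\<in>K. pmf x a * c a b))"
proof -
  have "measure_pmf.expectation (pair_pmf x y) (\<lambda>(a, b). c a b) =
    (\<Sum>ab\<in>K \<times> L. (case ab of (a, b) \<Rightarrow> c a b) * pmf (pair_pmf x y) ab)"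
    using assms by (intro integral_measure_pmf_real) auto
  also have "\<dots> = (\<Sum>a\<in>K. \<Sum>b\<in>L. c a b * (pmf x a * pmf y b))"
    unfolding sum.cartesian_product by (intro sum.cong) (auto simp: pmf_pair)
  also have "\<dots> = (\<Sum>b\<in>L. \<Sum>a\<in>K. c a b * (pmf x a * pmf y b))" by (rule sum.swap)
  finally show ?thesis by (simp add: sum_distrib_left mult_ac)
qed

text \<open>
  Von Neumann's theorem for a finite zero-sum game with payoff \<open>c\<close> to the row player. Only the inequality
  that bounds the value \<open>v\<close> of the right-hand side by the left-hand side has content. After subtracting
  \<open>v - e\<close> from the payoffs, every mixture of columns has a response with nonnegative payoff, so
  \<open>approachability\<close> gives a single mixed strategy that secures \<open>v - 2 e\<close> against every column, hence
  against every mixture of columns. This suffices because the two sides are suprema and infima.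
\<close>

theorem finite_minimax:
  fixes c :: "'k \<Rightarrow> 'l \<Rightarrow> real"
  assumes K: "finite K" "K \<noteq> {}" and L: "finite L" "L \<noteq> {}"
  defines "E \<equiv> \<lambda>x y. measure_pmf.expectation (pair_pmf x y) (\<lambda>(a, b). c a b)"
  shows "(SUP x\<in>{x. set_pmf x \<subseteq> K}. INF y\<in>{y. set_pmf y \<subseteq> L}. E x y) =
    (INF y\<in>{y. set_pmf y \<subseteq> L}. SUP x\<in>{x. set_pmf x \<subseteq> K}. E x y)"
proof -
  define P where "P = {x. set_pmf x \<subseteq> K}"
  define Q where "Q = {y. set_pmf y \<subseteq> L}"
  define B where "B = (\<Sum>b\<in>L. \<Sum>a\<in>K. \<bar>c a b\<bar>)"
  define row where "row x b = (\<Sum>a\<in>K. pmf x a * c a b)" for x b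
  have E: "E x y = (\<Sum>b\<in>L. pmf y b * row x b)" if "x \<in> P" "y \<in> Q" for x y
    using that K L unfolding P_def Q_def E_def row_def by (simp add: expectation_pair_pmf_finite)
  have row_bound: "\<bar>row x b\<bar> \<le> (\<Sum>a\<in>K. \<bar>c a b\<bar>)" for x b
    unfolding row_def
    by (rule order_trans[OF sum_abs], intro sum_mono)
      (simp add: abs_mult mult_left_le_one_le pmf_le_1)
  have row_le: "\<bar>row x b\<bar> \<le> B" if "b \<in> L" for x b
    unfolding B_def by (rule order_trans[OF row_bound member_le_sum[OF that]]) (auto simp: L sum_nonneg)
  have E_bound: "\<bar>E x y\<bar> \<le> B" if "x \<in> P" "y \<in> Q" for x y
    unfolding E[OF that] B_def
  proof (rule order_trans[OF sum_abs], intro sum_mono)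
    fix b
    have "\<bar>pmf y b * row x b\<bar> \<le> \<bar>row x b\<bar>"
      by (simp add: abs_mult mult_left_le_one_le pmf_le_1)
    also note row_bound
    finally show "\<bar>pmf y b * row x b\<bar> \<le> (\<Sum>a\<in>K. \<bar>c a b\<bar>)" .
  qed
  obtain a0 b0 where "a0 \<in> K" "b0 \<in> L" using K L by blast
  then have ne: "return_pmf a0 \<in> P" "return_pmf b0 \<in> Q" by (auto simp: P_def Q_def)
  have bdd_P: "bdd_above ((\<lambda>x. E x y) ` P)" if "y \<in> Q" for y
    using E_bound that by (intro bdd_aboveI2[where M = B]) force
  have bdd_Q: "bdd_below ((\<lambda>y. E x y) ` Q)" if "x \<in> P" for x
    using E_bound that by (intro bdd_belowI2[where m = "- B"]) (force simp: abs_le_iff)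
  define lower where "lower x = (INF y\<in>Q. E x y)" for x
  define upper where "upper y = (SUP x\<in>P. E x y)" for y
  have weak: "lower x \<le> upper y" if "x \<in> P" "y \<in> Q" for x y
    unfolding lower_def upper_def
    by (rule order_trans[OF cINF_lower[OF bdd_Q] cSUP_upper[OF _ bdd_P]]) (use that in auto)
  have bdd_lower: "bdd_above (lower ` P)"
    using weak ne by (intro bdd_aboveI2[where M = "upper (return_pmf b0)"]) auto
  have bdd_upper: "bdd_below (upper ` Q)"
    using weak ne by (intro bdd_belowI2[where m = "lower (return_pmf a0)"]) auto
  define v where "v = (INF y\<in>Q. upper y)"
  have "(SUP x\<in>P. lower x) = v"
  proof (rule antisym)
    show "(SUP x\<in>P. lower x) \<le> v"
      unfolding v_def using ne weak by (intro cSUP_least cINF_greatest) auto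
    show "v \<le> (SUP x\<in>P. lower x)"
    proof (rule field_le_epsilon)
      fix d :: real assume "0 < d"
      define e where "e = d / 2"
      have "0 < e" using \<open>0 < d\<close> by (simp add: e_def)
      define f where "f x b = row x b - (v - e)" for x b
      have "\<exists>x\<in>P. \<forall>b\<in>L. - e \<le> f x b"
      proof (rule approachability[where B = "B + \<bar>v - e\<bar>"])
        fix x x' :: "'k pmf" and t :: real
        assume xs: "x \<in> P" "x' \<in> P" and t: "0 \<le> t" "t \<le> 1"
        have "sum (\<lambda>a. (1 - t) * pmf x a + t * pmf x' a) K = 1"
          using xs K by (simp add: sum.distrib flip: sum_distrib_left) (simp add: P_def sum_pmf_eq_1)
        then obtain z where z: "set_pmf z \<subseteq> K"
            and pz: "\<And>a. a \<in> K \<Longrightarrow> pmf z a = (1 - t) * pmf x a + t * pmf x' a"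
          using pmf_with_weights[of K "\<lambda>a. (1 - t) * pmf x a + t * pmf x' a"] K t by auto
        have "row z b = (1 - t) * row x b + t * row x' b" for b
          by (simp add: row_def pz distrib_right sum.distrib sum_distrib_left mult.assoc)
        then have "f z b = (1 - t) * f x b + t * f x' b" for b
          by (simp add: f_def algebra_simps)
        with z show "\<exists>z\<in>P. \<forall>b\<in>L. f z b = (1 - t) * f x b + t * f x' b"
          by (auto simp: P_def)
      next
        fix x b assume "b \<in> L"
        then show "\<bar>f x b\<bar> \<le> B + \<bar>v - e\<bar>"
          using row_le[of b x] unfolding f_def by linarith
      next
        fix w :: "'l \<Rightarrow> real" assume w: "\<And>b. b \<in> L \<Longrightarrow> 0 \<le> w b"
        show "\<exists>x\<in>P. 0 \<le> (\<Sum>b\<in>L. w b * f x b)"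
        \<comment> \<open>a weight function is a multiple of a mixed strategy, except for the zero function\<close>
        proof (cases "sum w L = 0")
          case True
          then have "\<And>b. b \<in> L \<Longrightarrow> w b = 0" using w L by (simp add: sum_nonneg_eq_0_iff)
          then show ?thesis using ne by auto
        next
          case False
          then have pos: "0 < sum w L" using w by (simp add: sum_nonneg less_le)
          have "(\<Sum>b\<in>L. w b / sum w L) = 1" using False by (simp flip: sum_divide_distrib)
          then obtain y where y: "y \<in> Q" and py: "\<And>b. b \<in> L \<Longrightarrow> pmf y b = w b / sum w L"
            using pmf_with_weights[of L "\<lambda>b. w b / sum w L"] L w pos by (auto simp: Q_def)
          have "v \<le> upper y" unfolding v_def using y bdd_upper by (intro cINF_lower)
          then have "v - e < (SUP x\<in>P. E x y)" using \<open>0 < e\<close> by (simp add: upper_def)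
          then obtain x where x: "x \<in> P" and gt: "v - e < E x y"
            using less_cSUP_iff[OF _ bdd_P[OF y]] ne by blast
          have "(\<Sum>b\<in>L. w b * f x b) = sum w L * (\<Sum>b\<in>L. pmf y b * f x b)"
            using py pos by (simp add: sum_distrib_left)
          also have "(\<Sum>b\<in>L. pmf y b * f x b) = E x y - (v - e)"
            using L y unfolding E[OF x y] f_def
            by (simp add: right_diff_distrib sum_subtractf sum_pmf_eq_1 Q_def flip: sum_distrib_right)
          finally show ?thesis using gt pos x by (intro bexI[of _ x]) auto
        qed
      qed (use L ne \<open>0 < e\<close> in auto)
      then obtain x where x: "x \<in> P" and fx: "\<And>b. b \<in> L \<Longrightarrow> - e \<le> f x b" by blast
      have row_ge: "v - d \<le> row x b" if "b \<in> L" for b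
        using fx[OF that] unfolding f_def e_def by linarith
      have "v - d \<le> E x y" if y: "y \<in> Q" for y
      proof -
        have "v - d = (\<Sum>b\<in>L. pmf y b * (v - d))"
          using y L by (simp add: sum_pmf_eq_1 Q_def flip: sum_distrib_right)
        also have "\<dots> \<le> E x y"
          unfolding E[OF x y] by (intro sum_mono mult_left_mono row_ge) auto
        finally show ?thesis .
      qed
      then have "v - d \<le> lower x" unfolding lower_def using ne by (intro cINF_greatest) auto
      also have "\<dots> \<le> (SUP x\<in>P. lower x)" using x bdd_lower by (intro cSUP_upper)
      finally show "v \<le> (SUP x\<in>P. lower x) + d" by simp
    qed
  qed
  then show ?thesis unfolding v_def lower_def upper_def P_def Q_def .
qed

section \<open>Antisymmetry of the threat power\<close>

lemma joint_strategy_swap: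
  assumes "S \<subseteq> {1..N}"
  shows "joint_strategy N ({1..N} - S) y x = joint_strategy N S x y"
proof -
  have "merge ({1..N} - S) S (b, a) = merge S ({1..N} - S) (a, b)" for a b :: "nat \<Rightarrow> 'a"
    by (auto simp: merge_def)
  moreover have "{1..N} - ({1..N} - S) = S" using assms by auto
  ultimately show ?thesis
    unfolding joint_strategy_def
    by (subst pair_commute_pmf) (simp add: map_pmf_comp split_def)
qed

text \<open>
  The zero-sum game between \<open>S\<close> and its complement defines both threat powers: exchanging the two
  sides negates the objective and turns the maximin into the minimax. Hence the antisymmetry of the
  threat power is the minimax theorem for this game.
\<close>

theorem threat_power_complement:
  assumes game: "strategic_game N A" and S: "S \<subseteq> {1..N}"
  shows "threat_power N A g ({1..N} - S) = - threat_power N A g S"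
proof -
  let ?T = "{1..N} - S"
  have TT: "{1..N} - ?T = S" using S by auto
  define K where "K = Pi\<^sub>E S A"
  define L where "L = Pi\<^sub>E ?T A"
  have K: "finite K" "K \<noteq> {}" and L: "finite L" "L \<noteq> {}"
    using game S finite_subset[OF S] unfolding K_def L_def strategic_game_def
    by (auto intro!: finite_PiE simp: PiE_eq_empty_iff)
  define c where "c a b = (\<Sum>i\<in>S. g i (merge S ?T (a, b))) - (\<Sum>i\<in>?T. g i (merge S ?T (a, b)))"
    for a b
  define E where "E x y = measure_pmf.expectation (pair_pmf x y) (\<lambda>(a, b). c a b)" for x y
  let ?f = "\<lambda>x y. (\<Sum>i\<in>S. payoff g i (joint_strategy N S x y)) -
      (\<Sum>i\<in>?T. payoff g i (joint_strategy N S x y))"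
  have f: "?f x y = E x y" if "x \<in> {x. set_pmf x \<subseteq> K}" "y \<in> {y. set_pmf y \<subseteq> L}" for x y
  proof -
    have fin: "finite (set_pmf (pair_pmf x y))"
      using that K L by (auto intro: finite_subset)
    have int: "integrable (measure_pmf (pair_pmf x y)) h" for h :: "_ \<Rightarrow> real"
      using fin by (rule integrable_measure_pmf_finite)
    show ?thesis
      unfolding E_def payoff_def joint_strategy_def c_def split_def
      by (simp add: int)
  qed
  have neg: "(\<Sum>i\<in>?T. payoff g i (joint_strategy N ?T y x)) -
      (\<Sum>i\<in>S. payoff g i (joint_strategy N ?T y x)) = - ?f x y" for x y
    unfolding joint_strategy_swap[OF S] by simp
  have "threat_power N A g ?T = (SUP y\<in>{y. set_pmf y \<subseteq> L}. INF x\<in>{x. set_pmf x \<subseteq> K}. - E x y)"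
    unfolding threat_power_def correlated_strategies_def TT neg K_def[symmetric] L_def[symmetric]
    by (intro SUP_cong INF_cong refl arg_cong[of _ _ uminus] f)
  also have "\<dots> = - (INF y\<in>{y. set_pmf y \<subseteq> L}. SUP x\<in>{x. set_pmf x \<subseteq> K}. E x y)"
    by (simp add: Inf_real_def image_image)
  also have "\<dots> = - (SUP x\<in>{x. set_pmf x \<subseteq> K}. INF y\<in>{y. set_pmf y \<subseteq> L}. E x y)"
    using finite_minimax[OF K L, of c] by (simp add: E_def)
  also have "\<dots> = - threat_power N A g S"
    unfolding threat_power_def correlated_strategies_def K_def[symmetric] L_def[symmetric]
    by (intro arg_cong[of _ _ uminus] SUP_cong INF_cong refl f[symmetric])
  finally show ?thesis .
qed

section \<open>Orderings of the players and Shapley weights\<close>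

text \<open>
  The probability that, in a uniformly random ordering of \<open>N\<close> players, the predecessors of a given
  player form a given set of \<open>s\<close> other players.
\<close>

definition shapley_weight :: "nat \<Rightarrow> nat \<Rightarrow> real" where
  "shapley_weight N s = fact s * fact (N - 1 - s) / fact N"

lemma takeWhile_neq_append: "i \<notin> set xs \<Longrightarrow> takeWhile (\<lambda>j. j \<noteq> i) (xs @ i # ys) = xs"
  by (subst takeWhile_append2) auto

text \<open>
  Such an ordering is an arbitrary ordering of \<open>S\<close>, followed by \<open>i\<close>, followed by an arbitrary ordering
  of the remaining players.
\<close>

lemma card_orderings_with_predecessors:
  assumes V: "finite V" and i: "i \<in> V" and S: "S \<subseteq> V - {i}"
  shows "card {R \<in> permutations_of_set V. predecessors R i = S} =
    fact (card S) * fact (card V - 1 - card S)"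
proof -
  let ?W = "V - {i} - S"
  let ?glue = "\<lambda>(xs, ys). xs @ i # ys"
  have fin: "finite S" "finite ?W" using V S finite_subset by auto
  have "bij_betw ?glue (permutations_of_set S \<times> permutations_of_set ?W)
      {R \<in> permutations_of_set V. predecessors R i = S}"
    unfolding bij_betw_def
  proof (intro conjI equalityI subsetI)
    show "inj_on ?glue (permutations_of_set S \<times> permutations_of_set ?W)"
    proof (intro inj_onI, clarsimp)
      fix xs ys xs' ys'
      assume "xs \<in> permutations_of_set S" "xs' \<in> permutations_of_set S"
        and eq: "xs @ i # ys = xs' @ i # ys'"
      then have "i \<notin> set xs" "i \<notin> set xs'" using S by (auto simp: permutations_of_set_def)
      then have "xs = xs'" using eq by (metis takeWhile_neq_append)
      with eq show "xs = xs' \<and> ys = ys'" by simp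
    qed
  next
    fix R assume "R \<in> ?glue ` (permutations_of_set S \<times> permutations_of_set ?W)"
    then obtain xs ys where R: "R = xs @ i # ys" and
      xs: "xs \<in> permutations_of_set S" and ys: "ys \<in> permutations_of_set ?W" by auto
    then have "i \<notin> set xs" using S by (auto simp: permutations_of_set_def)
    then show "R \<in> {R \<in> permutations_of_set V. predecessors R i = S}"
      using xs ys S i unfolding R predecessors_def
      by (auto simp: permutations_of_set_def takeWhile_neq_append)
  next
    fix R assume R: "R \<in> {R \<in> permutations_of_set V. predecessors R i = S}"
    then have "i \<in> set R" and dist: "distinct R" and set: "set R = V"
      using i by (auto simp: permutations_of_set_def)
    then obtain xs ys where eq: "R = xs @ i # ys" and "i \<notin> set xs"
      using split_list_first by metis
    then have "set xs = S" using R by (simp add: predecessors_def takeWhile_neq_append)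
    then show "R \<in> ?glue ` (permutations_of_set S \<times> permutations_of_set ?W)"
      using dist set by (intro image_eqI[of _ _ "(xs, ys)"])
        (auto simp: eq permutations_of_set_def)
  qed
  then have "card {R \<in> permutations_of_set V. predecessors R i = S} =
      card (permutations_of_set S \<times> permutations_of_set ?W)"
    by (simp add: bij_betw_same_card)
  moreover have "card ?W = card V - 1 - card S"
    using S V i fin by (simp add: card_Diff_subset)
  ultimately show ?thesis using fin by (simp add: card_cartesian_product)
qed

lemma sum_over_orderings:
  fixes F :: "nat set \<Rightarrow> real"
  assumes i: "i \<in> {1..N}"
  shows "(\<Sum>R\<in>permutations_of_set {1..N}. F (predecessors R i)) / fact N =
    (\<Sum>S\<in>Pow ({1..N} - {i}). shapley_weight N (card S) * F S)"
proof -
  let ?O = "permutations_of_set {1..N}" and ?P = "Pow ({1..N} - {i})"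
  have pred: "predecessors R i \<in> ?P" if "R \<in> ?O" for R
    using that set_takeWhileD[of _ "\<lambda>j. j \<noteq> i" R]
    by (auto simp: permutations_of_set_def predecessors_def)
  have "(\<Sum>R\<in>?O. F (predecessors R i)) =
      (\<Sum>S\<in>?P. \<Sum>R\<in>{R \<in> ?O. predecessors R i = S}. F (predecessors R i))"
    using pred by (intro sum.group[symmetric]) auto
  also have "\<dots> = (\<Sum>S\<in>?P. real (card {R \<in> ?O. predecessors R i = S}) * F S)"
    by (intro sum.cong) auto
  also have "\<dots> = (\<Sum>S\<in>?P. fact (card S) * fact (N - 1 - card S) * F S)"
    using card_orderings_with_predecessors[of "{1..N}" i] i
    by (intro sum.cong refl) auto
  finally show ?thesis
    by (simp add: shapley_weight_def sum_divide_distrib)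
qed

text \<open>
  Complementation in the set of the players other than \<open>i\<close> preserves the weights and, by antisymmetry
  of \<open>d\<close>, turns \<open>d S\<close> into \<open>- d (insert i S)\<close>. In terms of orderings, this is their reversal. The two
  halves of each marginal contribution thus have equal totals.
\<close>

lemma self_dual_marginals:
  fixes d :: "nat set \<Rightarrow> real"
  assumes i: "i \<in> {1..N}" and dual: "\<And>S. S \<subseteq> {1..N} \<Longrightarrow> d ({1..N} - S) = - d S"
  shows "(\<Sum>S\<in>Pow ({1..N} - {i}). shapley_weight N (card S) * (d (insert i S) - d S)) =
    2 * (\<Sum>S\<in>Pow ({1..N} - {i}). shapley_weight N (card S) * d (insert i S))"
proof -
  let ?P = "Pow ({1..N} - {i})"
  have "(\<Sum>S\<in>?P. shapley_weight N (card S) * d S) =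
      (\<Sum>S\<in>?P. shapley_weight N (card ({1..N} - {i} - S)) * d ({1..N} - {i} - S))"
    by (rule sum.reindex_bij_witness[of _ "\<lambda>S. {1..N} - {i} - S" "\<lambda>S. {1..N} - {i} - S"])
      (auto simp: double_diff)
  also have "\<dots> = (\<Sum>S\<in>?P. shapley_weight N (card S) * - d (insert i S))"
  proof (intro sum.cong refl)
    fix S assume S: "S \<in> ?P"
    then have "finite S" and le: "card S \<le> N - 1"
      using finite_subset[of S "{1..N} - {i}"] card_mono[of "{1..N} - {i}" S] i by auto
    then have "card ({1..N} - {i} - S) = N - 1 - card S"
      using S i by (subst card_Diff_subset) auto
    moreover have "{1..N} - {i} - S = {1..N} - insert i S" by auto
    ultimately show "shapley_weight N (card ({1..N} - {i} - S)) * d ({1..N} - {i} - S) =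
        shapley_weight N (card S) * - d (insert i S)"
    proof -
      have "N - 1 - (N - 1 - card S) = card S" using le by simp
      moreover have "d ({1..N} - insert i S) = - d (insert i S)"
        using S i by (intro dual) auto
      ultimately show ?thesis
        unfolding \<open>card ({1..N} - {i} - S) = N - 1 - card S\<close> shapley_weight_def
        by (simp only: \<open>{1..N} - {i} - S = {1..N} - insert i S\<close> mult.commute )
    qed
  qed
  finally show ?thesis by (simp add: algebra_simps sum_subtractf sum_negf)
qed

section \<open>Functions on the hypercube\<close>

definition flip :: "nat \<Rightarrow> nat set \<Rightarrow> nat set" where
  "flip j S = (if j \<in> S then S - {j} else insert j S)"

lemma flip_in_Pow: "j \<in> {1..N} \<Longrightarrow> S \<in> Pow {1..N} \<Longrightarrow> flip j S \<in> Pow {1..N}"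
  by (auto simp: flip_def)

lemma inj_flip: "inj (\<lambda>j. flip j S)"
proof (rule injI)
  fix j k assume "flip j S = flip k S"
  then have "l \<in> flip j S \<longleftrightarrow> l \<in> flip k S" for l by simp
  from this[of j] this[of k] show "j = k" by (auto simp: flip_def split: if_splits)
qed

lemma neighbours_eq_flips:
  assumes "S \<in> Pow {1..N}" shows "neighbours N S = (\<lambda>j. flip j S) ` {1..N}"
proof (intro equalityI subsetI)
  fix T assume "T \<in> neighbours N S"
  then consider j where "j \<in> {1..N}" "S \<subseteq> {1..N} - {j}" "T = S \<union> {j}"
    | j where "j \<in> {1..N}" "T \<subseteq> {1..N} - {j}" "S = T \<union> {j}"
    unfolding neighbours_def hypercube_edge_def by blast
  then show "T \<in> (\<lambda>j. flip j S) ` {1..N}"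
    by cases (force simp: flip_def intro!: rev_image_eqI)+
next
  fix T assume "T \<in> (\<lambda>j. flip j S) ` {1..N}"
  then obtain j where "j \<in> {1..N}" "T = flip j S" by blast
  with assms show "T \<in> neighbours N S"
    by (cases "j \<in> S") (auto simp: neighbours_def hypercube_edge_def flip_def intro!: bexI[of _ j])
qed

lemma neighbours_sym: "T \<in> neighbours N S \<longleftrightarrow> S \<in> neighbours N T"
  by (auto simp: neighbours_def)

lemma pmf_uniform_neighbour:
  assumes "0 < N" "S \<in> Pow {1..N}"
  shows "pmf (pmf_of_set (neighbours N S)) T = indicator (neighbours N S) T / real N"
proof -
  have "card (neighbours N S) = N"
    unfolding neighbours_eq_flips[OF assms(2)] by (simp add: card_image inj_on_subset[OF inj_flip])
  moreover have "neighbours N S \<noteq> {}" "finite (neighbours N S)"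
    unfolding neighbours_eq_flips[OF assms(2)] using assms by auto
  ultimately show ?thesis by simp
qed

lemma sum_over_neighbours:
  fixes u :: "nat set \<Rightarrow> real"
  assumes S: "S \<in> Pow {1..N}"
  shows "(\<Sum>T\<in>Pow {1..N}. u T * indicator (neighbours N S) T) = (\<Sum>j\<in>{1..N}. u (flip j S))"
proof -
  have "(\<Sum>T\<in>Pow {1..N}. u T * indicator (neighbours N S) T) = (\<Sum>T\<in>neighbours N S. u T)"
  proof (intro sum.mono_neutral_cong_right)
    show "neighbours N S \<subseteq> Pow {1..N}"
      unfolding neighbours_eq_flips[OF S] using flip_in_Pow[OF _ S] by blast
  qed auto
  also have "\<dots> = (\<Sum>j\<in>{1..N}. u (flip j S))"
    unfolding neighbours_eq_flips[OF S] by (simp add: sum.reindex inj_on_subset[OF inj_flip])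
  finally show ?thesis .
qed

text \<open>
  A function that is harmonic away from the full set attains its maximum there. Indeed, at a maximum
  elsewhere all neighbours attain the maximum as well, in particular those with one more element, so a
  maximizer of largest cardinality is the full set.
\<close>

lemma maximum_principle:
  fixes D :: "nat set \<Rightarrow> real"
  assumes boundary: "D {1..N} \<le> 0"
    and harmonic: "\<And>S. S \<subset> {1..N} \<Longrightarrow> (\<Sum>j\<in>{1..N}. D (flip j S)) = real N * D S"
    and S: "S \<subseteq> {1..N}"
  shows "D S \<le> 0"
proof -
  define m where "m = Max (D ` Pow {1..N})"
  have le: "D T \<le> m" if "T \<in> Pow {1..N}" for T
    unfolding m_def using that by simp
  have "m \<in> D ` Pow {1..N}" unfolding m_def by (intro Max_in) auto
  then obtain T0 where "T0 \<in> Pow {1..N} \<and> D T0 = m" by blast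
  then obtain T where T: "T \<in> Pow {1..N}" "D T = m"
    and largest: "\<And>U. U \<in> Pow {1..N} \<Longrightarrow> D U = m \<Longrightarrow> card U \<le> card T"
    using ex_has_greatest_nat[of "\<lambda>T. T \<in> Pow {1..N} \<and> D T = m" T0 card "Suc N"]
      card_mono[of "{1..N}"] by (auto simp: less_Suc_eq_le)
  have "T = {1..N}"
  proof (rule ccontr)
    assume "T \<noteq> {1..N}"
    then have proper: "T \<subset> {1..N}" using T by auto
    then obtain j where j: "j \<in> {1..N}" "j \<notin> T" by blast
    have "(\<Sum>k\<in>{1..N}. m - D (flip k T)) = 0"
      using harmonic[OF proper] T by (simp add: sum_subtractf)
    moreover have "0 \<le> m - D (flip k T)" if "k \<in> {1..N}" for k
      using le[OF flip_in_Pow[OF that T(1)]] by simp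
    ultimately have "D (flip j T) = m"
      using j by (subst (asm) sum_nonneg_eq_0_iff) auto
    then have "card (insert j T) \<le> card T"
      using largest[OF flip_in_Pow[OF j(1) T(1)]] j by (simp add: flip_def)
    moreover have "finite T" using T finite_subset by auto
    ultimately show False using j by simp
  qed
  then show ?thesis using T boundary le[of S] S by simp
qed

section \<open>The Green function of the stopped walk\<close>

text \<open>
  The expected number of visits of the walk, started at the empty set and stopped at the full set, to a
  given set of \<open>s\<close> elements. It depends only on \<open>s\<close> by symmetry, and its decrements are the Shapley
  weights times \<open>N\<close>. The reason is conservation of the expected net number of crossings: the \<open>N choose s\<close>
  sets of \<open>s\<close> elements have together \<open>(N choose s) * (N - s)\<close> edges upwards, and the single unit
  of current that flows from the empty to the full set is split equally between them, which leaves
  \<open>s! (N - 1 - s)! / N!\<close> for each edge.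
\<close>

definition radial_green :: "nat \<Rightarrow> nat \<Rightarrow> real" where
  "radial_green N s = real N * (\<Sum>k\<in>{s..<N}. shapley_weight N k)"

lemma radial_green_nonneg: "0 \<le> radial_green N s"
  by (auto simp: radial_green_def shapley_weight_def intro!: mult_nonneg_nonneg sum_nonneg)

lemma radial_green_top: "radial_green N N = 0"
  by (simp add: radial_green_def)

lemma radial_green_step:
  "s < N \<Longrightarrow> radial_green N s = radial_green N (Suc s) + real N * shapley_weight N s"
  by (simp add: radial_green_def sum.atLeast_Suc_lessThan algebra_simps)

text \<open>
  Kirchhoff's law at a set of \<open>s + 1\<close> elements: the current out of its upper edges equals the current
  into it through its lower edges.
\<close>

lemma shapley_weight_flow:
  assumes "Suc s < N"
  shows "real (N - Suc s) * shapley_weight N (Suc s) = real (Suc s) * shapley_weight N s"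
proof -
  obtain m where N: "N = Suc (Suc s) + m" using assms by (metis less_natE add_Suc_right add_Suc)
  show ?thesis by (simp add: N shapley_weight_def)
qed

lemma shapley_weight_0: "0 < N \<Longrightarrow> real N * shapley_weight N 0 = 1"
  by (cases N) (simp_all add: shapley_weight_def)

text \<open>
  A unit source at the empty set, and no other source below the full set: the difference between the
  two sides is the net current out of \<open>S\<close>, which vanishes by \<open>shapley_weight_flow\<close>, except at the empty
  set, where it is 1 by \<open>shapley_weight_0\<close>.
\<close>

lemma radial_green_poisson:
  assumes S: "S \<subset> {1..N}"
  shows "real N * radial_green N (card S) = real N * of_bool (S = {}) +
    (\<Sum>j\<in>{1..N}. radial_green N (card (flip j S)))"
proof -
  let ?h = "radial_green N" and ?b = "shapley_weight N" and ?s = "card S"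
  have fin: "finite S" using S finite_subset by auto
  have lt: "?s < N" using psubset_card_mono[OF _ S] by simp
  have "(\<Sum>j\<in>{1..N}. ?h (card (flip j S))) =
      (\<Sum>j\<in>S. ?h (card (flip j S))) + (\<Sum>j\<in>{1..N} - S. ?h (card (flip j S)))"
    using S by (subst sum.subset_diff[of S]) auto
  also have "(\<Sum>j\<in>S. ?h (card (flip j S))) = real ?s * ?h (?s - 1)"
    using fin by (simp add: flip_def)
  also have "(\<Sum>j\<in>{1..N} - S. ?h (card (flip j S))) = real (N - ?s) * ?h (Suc ?s)"
    using fin S by (simp add: flip_def card_Diff_subset)
  finally have sum: "(\<Sum>j\<in>{1..N}. ?h (card (flip j S))) =
      real ?s * ?h (?s - 1) + real (N - ?s) * ?h (Suc ?s)" .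
  have up: "?h ?s = ?h (Suc ?s) + real N * ?b ?s" using lt by (rule radial_green_step)
  show ?thesis
  proof (cases "?s")
    case 0
    then have "S = {}" using fin by simp
    then show ?thesis
      using sum up shapley_weight_0[of N] lt by (simp add: algebra_simps)
  next
    case (Suc r)
    have down: "?h r = ?h ?s + real N * ?b r"
      using radial_green_step[of r N] lt Suc by simp
    have flow: "real (N - ?s) * ?b ?s = real ?s * ?b r"
      using shapley_weight_flow[of r N] lt Suc by simp
    have split: "real N = real ?s + real (N - ?s)" using lt by simp
    have "real N * ?h ?s = real ?s * ?h ?s + real (N - ?s) * ?h ?s"
      by (subst split) (simp add: distrib_right)
    also have "\<dots> = real ?s * (?h r - real N * ?b r) +
        real (N - ?s) * (?h (Suc ?s) + real N * ?b ?s)"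
      using down up by simp
    also have "\<dots> = real ?s * ?h r + real (N - ?s) * ?h (Suc ?s) +
        real N * (real (N - ?s) * ?b ?s - real ?s * ?b r)"
      by (simp add: algebra_simps)
    finally show ?thesis using sum Suc flow by auto
  qed
qed

section \<open>Differences along a coordinate direction\<close>

text \<open>
  Summation by parts along direction \<open>i\<close>: both endpoints of each edge \<open>(S, insert i S)\<close> contribute,
  with opposite signs.
\<close>

lemma sum_over_directed_edges:
  fixes u v :: "nat set \<Rightarrow> real"
  assumes i: "i \<in> {1..N}"
  shows "(\<Sum>S\<in>Pow {1..N}. u S * (v (flip i S) - v S)) =
    (\<Sum>S\<in>Pow ({1..N} - {i}). (u S - u (insert i S)) * (v (insert i S) - v S))"
proof -
  let ?P = "Pow ({1..N} - {i})" and ?t = "\<lambda>S. u S * (v (flip i S) - v S)"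
  have "Pow {1..N} = ?P \<union> insert i ` ?P"
    using Pow_insert[of i "{1..N} - {i}"] i by (simp add: insert_absorb)
  then have "sum ?t (Pow {1..N}) = sum ?t ?P + sum ?t (insert i ` ?P)"
    by (simp only:) (intro sum.union_disjoint, auto)
  also have "sum ?t (insert i ` ?P) = (\<Sum>S\<in>?P. ?t (insert i S))"
    by (intro sum.reindex_cong[of "insert i"]) (auto simp: inj_on_def)
  also have "\<dots> = (\<Sum>S\<in>?P. u (insert i S) * (v S - v (insert i S)))"
  proof (intro sum.cong refl)
    fix S assume "S \<in> ?P"
    then have "insert i S - {i} = S" by auto
    then show "?t (insert i S) = u (insert i S) * (v S - v (insert i S))"
      by (simp add: flip_def)
  qed
  also have "sum ?t ?P = (\<Sum>S\<in>?P. u S * (v (insert i S) - v S))"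
    by (intro sum.cong) (auto simp: flip_def)
  finally show ?thesis by (simp add: sum.distrib[symmetric] algebra_simps)
qed

lemma partial_diff_flip:
  assumes S: "S \<in> Pow {1..N}" and j: "j \<in> {1..N}"
  shows "partial_diff N i v S (flip j S) = (if j = i then v (flip i S) - v S else 0)"
proof (cases "j \<in> S")
  case True
  then have "hypercube_edge N (S - {j}) S" "\<not> hypercube_edge N S (S - {j})"
    using S j by (auto simp: hypercube_edge_def intro!: bexI[of _ j])
  moreover have "S = (S - {j}) \<union> {i} \<longleftrightarrow> j = i" using True by auto
  ultimately show ?thesis using True by (auto simp: partial_diff_def flip_def insert_absorb)
next
  case False
  then have "hypercube_edge N S (insert j S)"
    using S j by (auto simp: hypercube_edge_def intro!: bexI[of _ j])
  moreover have "insert j S = S \<union> {i} \<longleftrightarrow> j = i" using False by auto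
  ultimately show ?thesis using False by (auto simp: partial_diff_def flip_def)
qed

section \<open>The walk stopped at the full set\<close>

lemma hitting_time_ge_Suc:
  "enat (Suc n) \<le> hitting_time X S \<omega> \<longleftrightarrow> (\<forall>k\<le>n. X k \<omega> \<noteq> S)"
proof -
  have "enat (Suc n) \<le> hitting_time X S \<omega> \<longleftrightarrow> (\<forall>k. X k \<omega> = S \<longrightarrow> n < k)"
    by (auto simp: hitting_time_def le_INF_iff Suc_le_eq)
  also have "\<dots> \<longleftrightarrow> (\<forall>k\<le>n. X k \<omega> \<noteq> S)" by (auto simp flip: not_le)
  finally show ?thesis .
qed

context hypercube_walk
begin

abbreviation "grand \<equiv> {1..N}"

text \<open>
  The law at time \<open>n\<close> of the walk that is killed on reaching the full set. Its sum over \<open>n\<close> is the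
  expected number of visits to \<open>S\<close> before absorption.
\<close>

definition survival :: "nat \<Rightarrow> nat set \<Rightarrow> real" where
  "survival n S = prob {\<omega> \<in> space M. (\<forall>k\<le>n. X k \<omega> \<noteq> grand) \<and> X n \<omega> = S}"

definition crossing :: "nat \<Rightarrow> nat set \<Rightarrow> nat set \<Rightarrow> 'w set" where
  "crossing n S T = {\<omega> \<in> space M. (\<forall>k\<le>n. X k \<omega> \<noteq> grand) \<and> X n \<omega> = S \<and> X (Suc n) \<omega> = T}"

lemma X_in_Pow: "\<omega> \<in> space M \<Longrightarrow> X n \<omega> \<in> Pow grand"
  using measurable_space[OF measurable_X] by simp

lemma pred_X [measurable]: "Measurable.pred M (\<lambda>\<omega>. P (X n \<omega>))"
  using measurable_X by (rule measurable_compose) simp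

lemma sets_crossing [measurable]: "crossing n S T \<in> events"
  unfolding crossing_def by measurable

text \<open>
  The walk is specified by its finite path probabilities, so the Markov property for the event of
  survival comes from decomposing this event into the finitely many paths \<open>Hs\<close> that realize it.
\<close>

lemma prob_crossing:
  "prob (crossing n S T) = survival n S * pmf (pmf_of_set (neighbours N S)) T"
proof -
  define Hs where "Hs = {h \<in> {..n} \<rightarrow>\<^sub>E Pow grand. (\<forall>k\<le>n. h k \<noteq> grand) \<and> h n = S}"
  have fin: "finite Hs" unfolding Hs_def by (intro finite_subset[OF Collect_restrict]) (auto intro: finite_PiE)
  define cyl where "cyl h = {\<omega> \<in> space M. \<forall>k\<le>n. X k \<omega> = h k}" for h
  define cyl' where "cyl' h = {\<omega> \<in> space M. \<forall>k\<le>Suc n. X k \<omega> = (h(Suc n := T)) k}" for h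
  have path: "\<exists>h\<in>Hs. \<forall>k\<le>n. X k \<omega> = h k"
    if "\<omega> \<in> space M" "\<forall>k\<le>n. X k \<omega> \<noteq> grand" "X n \<omega> = S" for \<omega>
    using that X_in_Pow[OF that(1)] by (intro bexI[of _ "restrict (\<lambda>k. X k \<omega>) {..n}"]) (auto simp: Hs_def)
  have eq: "h = h'" if "h \<in> Hs" "h' \<in> Hs" "\<forall>k\<le>n. h k = h' k" for h h'
    using that by (intro PiE_ext[of h "{..n}" _ h']) (auto simp: Hs_def)
  have cyl'_iff: "\<omega> \<in> cyl' h \<longleftrightarrow> \<omega> \<in> cyl h \<and> X (Suc n) \<omega> = T" for \<omega> h
    by (auto simp: cyl'_def cyl_def le_Suc_eq)
  have disj: "disjoint_family_on cyl Hs"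
    unfolding disjoint_family_on_def cyl_def using eq by fastforce
  then have disj': "disjoint_family_on cyl' Hs"
    unfolding disjoint_family_on_def using cyl'_iff by blast
  have "crossing n S T = (\<Union>h\<in>Hs. cyl' h)"
    using path by (auto simp: crossing_def cyl'_iff) (auto simp: cyl_def Hs_def)
  moreover have "cyl' h \<in> events" for h unfolding cyl'_def by measurable
  ultimately have "prob (crossing n S T) = (\<Sum>h\<in>Hs. prob (cyl' h))"
    using fin disj' by (simp add: finite_measure_finite_Union image_subset_iff)
  also have "\<dots> = (\<Sum>h\<in>Hs. prob (cyl h) * pmf (pmf_of_set (neighbours N S)) T)"
  proof (intro sum.cong refl)
    fix h assume "h \<in> Hs"
    then have "h n = S" by (simp add: Hs_def)
    moreover have "{\<omega> \<in> space M. \<forall>k\<le>n. X k \<omega> = (h(Suc n := T)) k} = cyl h"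
      by (auto simp: cyl_def)
    ultimately show "prob (cyl' h) = prob (cyl h) * pmf (pmf_of_set (neighbours N S)) T"
      using step[of n "h(Suc n := T)"] by (simp add: cyl'_def)
  qed
  also have "\<dots> = (\<Sum>h\<in>Hs. prob (cyl h)) * pmf (pmf_of_set (neighbours N S)) T"
    by (simp add: sum_distrib_right)
  also have "(\<Sum>h\<in>Hs. prob (cyl h)) = prob (\<Union>h\<in>Hs. cyl h)"
  proof (rule finite_measure_finite_Union[symmetric])
    show "cyl ` Hs \<subseteq> events" unfolding cyl_def by (intro image_subsetI) measurable
  qed (use fin disj in auto)
  also have "(\<Union>h\<in>Hs. cyl h) = {\<omega> \<in> space M. (\<forall>k\<le>n. X k \<omega> \<noteq> grand) \<and> X n \<omega> = S}"
    using path by (auto simp: cyl_def) (auto simp: Hs_def)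
  finally show ?thesis by (simp add: survival_def)
qed

lemma
  fixes c :: "nat set \<Rightarrow> nat set \<Rightarrow> real"
  shows integrable_crossings: "integrable M
      (\<lambda>\<omega>. \<Sum>S\<in>Pow grand. \<Sum>T\<in>Pow grand. c S T * indicator (crossing n S T) \<omega>)" (is ?int)
    and expectation_crossings: "(\<integral>\<omega>. (\<Sum>S\<in>Pow grand. \<Sum>T\<in>Pow grand. c S T * indicator (crossing n S T) \<omega>) \<partial>M) =
      (\<Sum>S\<in>Pow grand. survival n S * (\<Sum>T\<in>Pow grand. c S T * pmf (pmf_of_set (neighbours N S)) T))" (is ?exp)
proof -
  have int: "integrable M (\<lambda>\<omega>. c S T * indicat_real (crossing n S T) \<omega>)" for S T
    by (intro integrable_mult_right) (simp add: emeasure_eq_measure)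
  show ?int by (intro Bochner_Integration.integrable_sum int)
  have "(\<integral>\<omega>. (\<Sum>S\<in>Pow grand. \<Sum>T\<in>Pow grand. c S T * indicator (crossing n S T) \<omega>) \<partial>M) =
      (\<Sum>S\<in>Pow grand. \<integral>\<omega>. (\<Sum>T\<in>Pow grand. c S T * indicator (crossing n S T) \<omega>) \<partial>M)"
    by (intro Bochner_Integration.integral_sum Bochner_Integration.integrable_sum int)
  also have "\<dots> = (\<Sum>S\<in>Pow grand. \<Sum>T\<in>Pow grand. \<integral>\<omega>. c S T * indicator (crossing n S T) \<omega> \<partial>M)"
    by (intro sum.cong refl Bochner_Integration.integral_sum int)
  also have "\<dots> = (\<Sum>S\<in>Pow grand. \<Sum>T\<in>Pow grand. c S T * prob (crossing n S T))"
    by (simp add: sets.Int_space_eq2)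
  finally show ?exp by (simp add: prob_crossing sum_distrib_left mult_ac)
qed

lemma survival_nonneg: "0 \<le> survival n S"
  by (simp add: survival_def)

lemma survival_full: "survival n grand = 0"
proof -
  have "{\<omega> \<in> space M. (\<forall>k\<le>n. X k \<omega> \<noteq> grand) \<and> X n \<omega> = grand} = {}" by auto
  then show ?thesis by (simp only: survival_def measure_empty)
qed

lemma survival_0:
  assumes "S \<noteq> grand" shows "survival 0 S = of_bool (S = {})"
proof -
  have "survival 0 S = prob {\<omega> \<in> space M. S = {}}"
    unfolding survival_def using start assms
    by (intro finite_measure_eq_AE) (auto elim!: eventually_mono)
  then show ?thesis by (simp add: prob_space)
qed

lemma survival_Suc:
  assumes "0 < N" and S: "S \<subset> grand"
  shows "survival (Suc n) S = (\<Sum>j\<in>grand. survival n (flip j S)) / real N"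
proof -
  have "{\<omega> \<in> space M. (\<forall>k\<le>Suc n. X k \<omega> \<noteq> grand) \<and> X (Suc n) \<omega> = S} = (\<Union>T\<in>Pow grand. crossing n T S)"
    using S X_in_Pow by (auto simp: crossing_def le_Suc_eq)
  moreover have "disjoint_family_on (\<lambda>T. crossing n T S) (Pow grand)"
    by (auto simp: disjoint_family_on_def crossing_def)
  ultimately have "survival (Suc n) S = (\<Sum>T\<in>Pow grand. prob (crossing n T S))"
    unfolding survival_def by (simp add: finite_measure_finite_Union image_subset_iff)
  also have "\<dots> = (\<Sum>T\<in>Pow grand. survival n T * indicator (neighbours N S) T) / real N"
    unfolding prob_crossing sum_divide_distrib
  proof (intro sum.cong refl)
    fix T assume "T \<in> Pow grand"
    moreover have "indicator (neighbours N T) S = (indicator (neighbours N S) T :: real)"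
      by (simp add: indicator_def neighbours_sym)
    ultimately show "survival n T * pmf (pmf_of_set (neighbours N T)) S =
        survival n T * indicator (neighbours N S) T / real N"
      using assms(1) by (simp add: pmf_uniform_neighbour)
  qed
  finally show ?thesis using sum_over_neighbours[of S N "survival n"] S by auto
qed

lemma partial_visits:
  assumes "0 < N" and S: "S \<subset> grand"
  shows "(\<Sum>n<Suc m. survival n S) =
    of_bool (S = {}) + (\<Sum>j\<in>grand. \<Sum>n<m. survival n (flip j S)) / real N"
proof -
  have "(\<Sum>n<Suc m. survival n S) = survival 0 S + (\<Sum>n<m. survival (Suc n) S)"
    by (rule sum.lessThan_Suc_shift)
  also have "(\<Sum>n<m. survival (Suc n) S) = (\<Sum>n<m. \<Sum>j\<in>grand. survival n (flip j S)) / real N"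
    by (simp add: survival_Suc[OF assms] sum_divide_distrib)
  also have "(\<Sum>n<m. \<Sum>j\<in>grand. survival n (flip j S)) = (\<Sum>j\<in>grand. \<Sum>n<m. survival n (flip j S))"
    by (rule sum.swap)
  finally show ?thesis using S by (simp add: survival_0)
qed

text \<open>
  The truncated visit counts arise from 0 by iterating the monotone operator whose fixed point is the
  Green function, and therefore stay below it. This gives summability in \<open>n\<close> and, as a consequence, the almost
  sure finiteness of the hitting time.
\<close>

lemma partial_visits_le:
  assumes "0 < N" and "S \<subseteq> grand"
  shows "(\<Sum>n<m. survival n S) \<le> radial_green N (card S)"
  using assms(2)
proof (induction m arbitrary: S)
  case 0
  then show ?case by (simp add: radial_green_nonneg)
next
  case (Suc m)
  show ?case
  proof (cases "S = grand")
    case True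
    then show ?thesis by (simp only: survival_full) (simp add: radial_green_nonneg)
  next
    case False
    then have S: "S \<subset> grand" using Suc.prems by auto
    have "(\<Sum>j\<in>grand. \<Sum>n<m. survival n (flip j S)) \<le> (\<Sum>j\<in>grand. radial_green N (card (flip j S)))"
      using flip_in_Pow[of _ N S] Suc.prems by (intro sum_mono Suc.IH) blast
    then have "(\<Sum>n<Suc m. survival n S) \<le>
        of_bool (S = {}) + (\<Sum>j\<in>grand. radial_green N (card (flip j S))) / real N"
      unfolding partial_visits[OF assms(1) S] by (simp add: divide_right_mono)
    also have "\<dots> = radial_green N (card S)"
      using radial_green_poisson[OF S] assms(1) by (simp add: field_simps)
    finally show ?thesis .
  qed
qed

text \<open>
  The total visit counts and \<open>radial_green\<close> solve the same Poisson equation with the same value 0 at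
  the full set, so their difference is harmonic and the maximum principle identifies them.
\<close>

lemma expected_visits:
  assumes "0 < N" and "S \<subseteq> grand"
  shows "(\<lambda>n. survival n S) sums radial_green N (card S)"
proof -
  have summable: "summable (\<lambda>n. survival n S)" if "S \<subseteq> grand" for S
  proof (rule summableI_nonneg_bounded)
    show "(\<Sum>n<m. survival n S) \<le> radial_green N (card S)" for m
      by (rule partial_visits_le[OF assms(1) that])
  qed (rule survival_nonneg)
  define G where "G S = (\<Sum>n. survival n S)" for S
  define D where "D S = radial_green N (card S) - G S" for S
  have "D S \<le> 0"
  proof (rule maximum_principle[OF _ _ assms(2)])
    show "D grand \<le> 0" by (simp only: D_def G_def survival_full) (simp add: radial_green_top)
  next
    fix S assume S: "S \<subset> grand"
    then have sub: "flip j S \<subseteq> grand" if "j \<in> grand" for j using flip_in_Pow[OF that] by blast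
    have "(\<lambda>m. of_bool (S = {}) + (\<Sum>j\<in>grand. \<Sum>n<m. survival n (flip j S)) / real N)
        \<longlonglongrightarrow> of_bool (S = {}) + (\<Sum>j\<in>grand. G (flip j S)) / real N"
      unfolding G_def using summable sub by (intro tendsto_intros summable_LIMSEQ) (use assms(1) in auto)
    moreover have "(\<lambda>m. \<Sum>n<Suc m. survival n S) \<longlonglongrightarrow> G S"
      unfolding G_def using summable S by (intro LIMSEQ_Suc summable_LIMSEQ) auto
    ultimately have "G S = of_bool (S = {}) + (\<Sum>j\<in>grand. G (flip j S)) / real N"
      unfolding partial_visits[OF assms(1) S] by (rule LIMSEQ_unique[symmetric])
    then show "(\<Sum>j\<in>grand. D (flip j S)) = real N * D S"
      using radial_green_poisson[OF S] assms(1) by (simp add: D_def sum_subtractf field_simps)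
  qed
  moreover have "G S \<le> radial_green N (card S)"
    unfolding G_def using summable[OF assms(2)] partial_visits_le[OF assms]
    by (intro suminf_le_const)
  ultimately have "G S = radial_green N (card S)" by (simp add: D_def)
  then show ?thesis using summable[OF assms(2)] unfolding G_def by (metis summable_sums)
qed

text \<open>
  The probability of survival up to time \<open>n\<close> is a finite sum of terms of convergent series, so it
  tends to 0.
\<close>

lemma AE_hits_full:
  assumes "0 < N" shows "AE \<omega> in M. \<exists>n. X n \<omega> = grand"
proof -
  define avoid where "avoid n = {\<omega> \<in> space M. \<forall>k\<le>n. X k \<omega> \<noteq> grand}" for n
  define never where "never = {\<omega> \<in> space M. \<forall>n. X n \<omega> \<noteq> grand}"
  have meas: "avoid n \<in> events" "never \<in> events" for n unfolding avoid_def never_def by measurable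
  have "prob (avoid n) = (\<Sum>S\<in>Pow grand. survival n S)" for n
  proof -
    have "avoid n = (\<Union>S\<in>Pow grand. {\<omega> \<in> space M. (\<forall>k\<le>n. X k \<omega> \<noteq> grand) \<and> X n \<omega> = S})"
      using X_in_Pow by (auto simp: avoid_def)
    then show ?thesis
      unfolding survival_def
      by (simp only:) (intro finite_measure_finite_Union, auto simp: disjoint_family_on_def)
  qed
  moreover have "(\<lambda>n. \<Sum>S\<in>Pow grand. survival n S) \<longlonglongrightarrow> (\<Sum>S\<in>Pow grand. 0)"
    using expected_visits[OF assms] by (intro tendsto_sum summable_LIMSEQ_zero sums_summable) auto
  ultimately have "(\<lambda>n. prob (avoid n)) \<longlonglongrightarrow> 0" by simp
  moreover have "prob never \<le> prob (avoid n)" for n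
    using meas by (intro finite_measure_mono) (auto simp: never_def avoid_def)
  ultimately have "prob never \<le> 0" by (intro LIMSEQ_le_const) auto
  then have "prob never = 0" by (simp add: measure_le_0_iff)
  then have "never \<in> null_sets M" using meas by (simp add: null_sets_def emeasure_eq_measure)
  then show ?thesis by (rule AE_I') (auto simp: never_def)
qed

text \<open>
  The Shapley value of \<open>v\<close> for player \<open>i\<close> is the right-hand side. The expected increment at time \<open>n\<close>,
  given that the walk is at \<open>S\<close>, is \<open>(v (flip i S) - v S) / N\<close>. Summing over all times replaces the
  probability of being at \<open>S\<close> by the expected number of visits, and summation by parts in direction
  \<open>i\<close> leaves the decrements of the Green function divided by \<open>N\<close>, which are the Shapley weights.
\<close>

lemma value_operator_full:
  assumes i: "i \<in> grand"
  shows "value_operator N M X v i grand =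
    (\<Sum>S\<in>Pow (grand - {i}). shapley_weight N (card S) * (v (insert i S) - v S))"
proof -
  have N: "0 < N" using i by auto
  define f where "f = partial_diff N i v"
  \<comment> \<open>the increment at step n + 1, set to 0 once the walk is absorbed, in a form that
    makes its measurability and its expectation evident\<close>
  define Z where "Z n \<omega> = (\<Sum>S\<in>Pow grand. \<Sum>T\<in>Pow grand. f S T * indicator (crossing n S T) \<omega>)" for n \<omega>
  \<comment> \<open>the expected increment when the walk leaves S\<close>
  define d where "d S = (\<Sum>T\<in>Pow grand. f S T * pmf (pmf_of_set (neighbours N S)) T)" for S
  have Z: "Z n \<omega> = (if \<forall>k\<le>n. X k \<omega> \<noteq> grand then f (X n \<omega>) (X (Suc n) \<omega>) else 0)"
    if "\<omega> \<in> space M" for n \<omega>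
  proof -
    have "Z n \<omega> = (\<Sum>S\<in>Pow grand. \<Sum>T\<in>Pow grand. if T = X (Suc n) \<omega> then
        (if S = X n \<omega> then (if \<forall>k\<le>n. X k \<omega> \<noteq> grand then f S T else 0) else 0) else 0)"
      unfolding Z_def using that by (intro sum.cong refl) (auto simp: crossing_def indicator_def)
    then show ?thesis using X_in_Pow[OF that] by (simp add: sum.delta)
  qed
  have d: "d S = (v (flip i S) - v S) / real N" if S: "S \<in> Pow grand" for S
  proof -
    have "d S = (\<Sum>T\<in>Pow grand. f S T * indicator (neighbours N S) T) / real N"
      unfolding d_def pmf_uniform_neighbour[OF N S] sum_divide_distrib by simp
    also have "\<dots> = (\<Sum>j\<in>grand. f S (flip j S)) / real N"
      by (simp only: sum_over_neighbours[OF S])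
    also have "(\<Sum>j\<in>grand. f S (flip j S)) = (\<Sum>j\<in>grand. if j = i then v (flip i S) - v S else 0)"
      unfolding f_def by (intro sum.cong partial_diff_flip[OF S] refl)
    finally show ?thesis using i by simp
  qed
  have intZ: "integrable M (Z n)" for n
    unfolding Z_def by (rule integrable_crossings)
  have expZ: "(\<integral>\<omega>. Z n \<omega> \<partial>M) = (\<Sum>S\<in>Pow grand. survival n S * d S)" for n
    unfolding Z_def d_def by (rule expectation_crossings)
  have sums: "(\<lambda>n. \<integral>\<omega>. Z n \<omega> \<partial>M) sums (\<Sum>S\<in>Pow grand. radial_green N (card S) * d S)"
    unfolding expZ by (intro sums_sum sums_mult2 expected_visits[OF N]) auto
  have abs_sum: "summable (\<lambda>n. \<integral>\<omega>. norm (Z n \<omega>) \<partial>M)"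
  proof (rule summable_comparison_test')
    let ?b = "\<lambda>n. \<Sum>S\<in>Pow grand. survival n S *
        (\<Sum>T\<in>Pow grand. \<bar>f S T\<bar> * pmf (pmf_of_set (neighbours N S)) T)"
    show "summable ?b"
      using expected_visits[OF N]
      by (intro summable_sum summable_mult2 sums_summable) auto
    fix n :: nat
    have "(\<integral>\<omega>. norm (Z n \<omega>) \<partial>M) \<le>
        (\<integral>\<omega>. (\<Sum>S\<in>Pow grand. \<Sum>T\<in>Pow grand. \<bar>f S T\<bar> * indicator (crossing n S T) \<omega>) \<partial>M)"
    proof (intro integral_mono integrable_crossings integrable_norm intZ)
      fix \<omega>
      show "norm (Z n \<omega>) \<le> (\<Sum>S\<in>Pow grand. \<Sum>T\<in>Pow grand. \<bar>f S T\<bar> * indicator (crossing n S T) \<omega>)"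
        unfolding Z_def
        by (intro order_trans[OF norm_sum] sum_mono) (simp add: abs_mult)
    qed
    also have "\<dots> = ?b n"
      by (rule expectation_crossings)
    finally show "norm (\<integral>\<omega>. norm (Z n \<omega>) \<partial>M) \<le> ?b n" by simp
  qed
  let ?S = "\<lambda>\<omega>. \<Sum>n | 1 \<le> n \<and> enat n \<le> hitting_time X grand \<omega>. f (X (n - 1) \<omega>) (X n \<omega>)"
  have index: "{n. 1 \<le> n \<and> enat n \<le> hitting_time X grand \<omega>} = Suc ` {n. \<forall>k\<le>n. X k \<omega> \<noteq> grand}" for \<omega>
  proof (intro set_eqI)
    fix n
    show "n \<in> {n. 1 \<le> n \<and> enat n \<le> hitting_time X grand \<omega>} \<longleftrightarrow> n \<in> Suc ` {n. \<forall>k\<le>n. X k \<omega> \<noteq> grand}"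
      by (cases n) (auto simp: hitting_time_ge_Suc)
  qed
  have stopped: "summable (\<lambda>n. norm (Z n \<omega>)) \<and> ?S \<omega> = (\<Sum>n. Z n \<omega>)"
    if \<omega>: "\<omega> \<in> space M" and hit: "X m \<omega> = grand" for \<omega> m
  proof -
    let ?I = "{n. \<forall>k\<le>n. X k \<omega> \<noteq> grand}"
    have "?I \<subseteq> {..<m}" using hit by (auto simp flip: not_le)
    then have fin: "finite ?I" by (rule finite_subset) simp
    have zero: "Z n \<omega> = 0" if "n \<notin> ?I" for n using that Z[OF \<omega>, of n] by auto
    have "?S \<omega> = (\<Sum>n\<in>?I. f (X n \<omega>) (X (Suc n) \<omega>))"
      unfolding index by (simp add: sum.reindex)
    also have "\<dots> = (\<Sum>n\<in>?I. Z n \<omega>)"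
      using Z[OF \<omega>] by (intro sum.cong) auto
    also have "\<dots> = (\<Sum>n. Z n \<omega>)"
      using fin zero by (intro suminf_finite[symmetric])
    finally show ?thesis
      using summable_finite[OF fin, of "\<lambda>n. norm (Z n \<omega>)"] zero by simp
  qed
  have unstopped: "?S \<omega> = 0" if "\<nexists>m. X m \<omega> = grand" for \<omega>
  proof -
    have "{n. \<forall>k\<le>n. X k \<omega> \<noteq> grand} = UNIV" using that by auto
    then have "infinite {n. 1 \<le> n \<and> enat n \<le> hitting_time X grand \<omega>}"
      unfolding index by (simp add: finite_image_iff)
    then show ?thesis by (rule sum.infinite)
  qed
  have measZ [measurable]: "Z n \<in> borel_measurable M" for n
    using intZ by (rule borel_measurable_integrable)
  \<comment> \<open>the value operator vanishes on paths that never reach the full set, where the series of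
    the increments need not converge; these paths form a null event\<close>
  have "value_operator N M X v i grand =
      (\<integral>\<omega>. (if \<exists>m. X m \<omega> = grand then \<Sum>n. Z n \<omega> else 0) \<partial>M)"
    unfolding value_operator_def f_def[symmetric]
    using stopped unstopped by (intro Bochner_Integration.integral_cong refl) auto
  also have "\<dots> = (\<integral>\<omega>. (\<Sum>n. Z n \<omega>) \<partial>M)"
    using AE_hits_full[OF N] by (intro integral_cong_AE) auto
  also have "\<dots> = (\<Sum>n. \<integral>\<omega>. Z n \<omega> \<partial>M)"
    using AE_hits_full[OF N] AE_space stopped
    by (intro integral_suminf intZ abs_sum) (auto elim: eventually_elim2)
  also have "\<dots> = (\<Sum>S\<in>Pow grand. radial_green N (card S) * d S)"
    using sums by (rule sums_unique[symmetric])
  also have "\<dots> = (\<Sum>S\<in>Pow grand. radial_green N (card S) / real N * (v (flip i S) - v S))"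
    by (intro sum.cong) (auto simp: d)
  also have "\<dots> = (\<Sum>S\<in>Pow (grand - {i}).
      (radial_green N (card S) / real N - radial_green N (card (insert i S)) / real N) *
      (v (insert i S) - v S))"
    by (rule sum_over_directed_edges[OF i])
  also have "\<dots> = (\<Sum>S\<in>Pow (grand - {i}). shapley_weight N (card S) * (v (insert i S) - v S))"
  proof (intro sum.cong refl)
    fix S assume S: "S \<in> Pow (grand - {i})"
    then have "finite S" "i \<notin> S" using finite_subset by auto
    moreover have "card S < N"
    proof -
      have "S \<subset> grand" using S i by blast
      from psubset_card_mono[OF _ this] show ?thesis by simp
    qed
    ultimately show "(radial_green N (card S) / real N - radial_green N (card (insert i S)) / real N) *
      (v (insert i S) - v S) = shapley_weight N (card S) * (v (insert i S) - v S)"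
      using N by (simp add: radial_green_step add_divide_distrib)
  qed
  finally show ?thesis .
qed

end

section \<open>The value operator extends the value of Nash, Kohlberg and Neyman\<close>

theorem theorem3p1:
  fixes N :: nat and A :: "nat \<Rightarrow> 'a set" and g :: "nat \<Rightarrow> (nat \<Rightarrow> 'a) \<Rightarrow> real"
    and M :: "'w measure" and X :: "nat \<Rightarrow> 'w \<Rightarrow> nat set"
  assumes "strategic_game N A"
    and "hypercube_walk M N X"
  shows "\<forall>i\<in>{1..N}. value_operator N M X (coalition_game N A g) i {1..N} = kn_value N A g i"
proof
  fix i assume i: "i \<in> {1..N}"
  interpret hypercube_walk M N X by (fact assms(2))
  let ?P = "Pow ({1..N} - {i})" and ?\<delta> = "threat_power N A g"
  have "value_operator N M X (coalition_game N A g) i {1..N} =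
      (\<Sum>S\<in>?P. shapley_weight N (card S) * (?\<delta> (insert i S) - ?\<delta> S)) / 2"
    unfolding value_operator_full[OF i] sum_divide_distrib
    by (intro sum.cong) (auto simp: coalition_game_def field_simps)
  also have "\<dots> = (\<Sum>S\<in>?P. shapley_weight N (card S) * ?\<delta> (insert i S))"
    using self_dual_marginals[of i N ?\<delta>, OF i threat_power_complement[OF assms(1)]] by simp
  also have "\<dots> = kn_value N A g i"
    unfolding kn_value_def using sum_over_orderings[OF i, of "\<lambda>S. ?\<delta> (insert i S)"] by simp
  finally show "value_operator N M X (coalition_game N A g) i {1..N} = kn_value N A g i" .
qed

end
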